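(* We have \[ \sum_{\substack{k, m, n \geq 1\\ k \text{ odd}}} \frac{1}{3^n} \, \frac{1}{k (k + m) (k + m + n)} = \frac{13}{48}\, \zeta(3), \] where the sum runs over all triples $(k,m,n)$ of positive integers with $k$ odd.
   Context: $\zeta$ denotes the Riemann zeta function, so $\zeta(3) = \sum_{n=1}^\infty 1/n^3$. *)

theory Defs
  imports "HOL-Analysis.Analysis"
begin

(* The Riemann zeta function on the real half-line s > 1, where it is given by its
   Dirichlet series; for s \<le> 1 the series diverges and the value is meaningless.
   The summation index is shifted by one, so the n-th term is 1 / (n + 1)^s. *)
definition zeta :: "real \<Rightarrow> real" where
  "zeta s = (\<Sum>n. 1 / real (Suc n) powr s)"

end

theory Submission
  imports Defs "HOL-Real_Asymp.Real_Asymp"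
begin

text \<open>
  With \<open>l = k + m\<close> and \<open>p = k + m + n\<close>, inserting \<open>x ^ p\<close> turns the sum into an iterated integral
  \<open>F(x)\<close> with \<open>F' = B / (3 - x)\<close> and \<open>B' = (ln (1 + x) - ln (1 - x)) / (2 (1 - x))\<close>. Integrating by
  parts and substituting \<open>v = (1 - x) / 2\<close>, the value at \<open>x = 1\<close> is \<open>J(1/2) / 2\<close>, where
  \<open>J' (v) = ln ((1 - v) / v) ln (1 + v) / v\<close> and \<open>J(0) = 0\<close>. The function \<open>J\<close> is a combination of di- and
  trilogarithms, and \<open>J(1/2)\<close> contains the trilogarithm only through \<open>Li 3 (- 1/3) - 2 Li 3 (1/3)\<close>
  and \<open>Li 3 (1/2)\<close>. The Spence-Kummer equation at \<open>x = 1/2\<close>, where \<open>(1 - x) / (1 + x)\<close> and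
  \<open>x / (1 + x)\<close> both equal \<open>1/3\<close>, evaluates the former, with the help of Landen's equation and duplication.
\<close>

section \<open>Integrating power series and comparing functions by derivatives\<close>

lemma powser_antiderivative:
  fixes a :: "nat \<Rightarrow> real"
  assumes sums: "\<And>x. \<bar>x\<bar> < 1 \<Longrightarrow> (\<lambda>n. a n * x ^ n) sums f x" and x: "\<bar>x\<bar> < 1"
  shows "summable (\<lambda>n. a n / Suc n * x ^ Suc n)"
    and "((\<lambda>x. \<Sum>n. a n / Suc n * x ^ Suc n) has_real_derivative f x) (at x)"
proof -
  \<comment> \<open>Shifting the coefficients by one, with \<open>c 0 = 0\<close>, makes the
    integrated series an ordinary power series, which can be differentiated term by term.\<close>
  define c where "c = (\<lambda>n. case n of 0 \<Rightarrow> 0 | Suc m \<Rightarrow> a m / Suc m)"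
  have c: "c 0 = 0" "\<And>n. c (Suc n) = a n / Suc n" by (simp_all add: c_def)
  have eq: "(\<lambda>n. a n / Suc n * x ^ Suc n) sums s \<longleftrightarrow> (\<lambda>n. c n * x ^ n) sums s" for x s
    using sums_Suc_iff[of "\<lambda>n. c n * x ^ n" s] by (simp only: c mult_zero_left add_0_right)
  have sm: "summable (\<lambda>n. a n / Suc n * x ^ Suc n)" if "\<bar>x\<bar> < 1" for x
  proof (rule summable_comparison_test')
    obtain r where r: "\<bar>x\<bar> < r" "r < 1" using dense[OF \<open>\<bar>x\<bar> < 1\<close>] by auto
    have "summable (\<lambda>n. a n * r ^ n)" using sums[of r] r sums_summable by auto
    from powser_insidea[OF this, of x] r show "summable (\<lambda>n. norm (a n * x ^ n))" by simp
    show "norm (a n / Suc n * x ^ Suc n) \<le> norm (a n * x ^ n)" if "n \<ge> 0" for n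
    proof -
      have "\<bar>a n\<bar> * (\<bar>x\<bar> ^ n * (\<bar>x\<bar> / Suc n)) \<le> \<bar>a n\<bar> * (\<bar>x\<bar> ^ n * 1)"
        using \<open>\<bar>x\<bar> < 1\<close> by (intro mult_left_mono) (auto simp: field_simps)
      then show ?thesis by (simp add: abs_mult power_abs mult_ac)
    qed
  qed
  show "summable (\<lambda>n. a n / Suc n * x ^ Suc n)" using sm x .
  have sm': "summable (\<lambda>n. c n * x ^ n)" if "norm x < 1" for x
    using sm[of x] that eq[of x] by (simp only: summable_def real_norm_def)
  have "((\<lambda>x. \<Sum>n. c n * x ^ n) has_real_derivative (\<Sum>n. diffs c n * x ^ n)) (at x)"
    by (rule termdiffs_strong'[where K = 1]) (use sm' x in auto)
  moreover have "(\<Sum>n. diffs c n * x ^ n) = f x"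
    using sums[OF x] by (simp add: diffs_def sums_iff c)
  moreover have "(\<lambda>x. \<Sum>n. c n * x ^ n) = (\<lambda>x. \<Sum>n. a n / Suc n * x ^ Suc n)"
    by (simp only: suminf_def eq)
  ultimately show "((\<lambda>x. \<Sum>n. a n / Suc n * x ^ Suc n) has_real_derivative f x) (at x)"
    by simp
qed

text \<open>The difference is constant, and its limit at the left end identifies the constant.
  Asking only for a limit allows terms such as \<open>ln x\<close> that are singular there. Most
  functional equations and closed forms below follow from it with \<open>a = 0\<close>.\<close>

lemma eq_if_same_derivative:
  fixes f g f' :: "real \<Rightarrow> real"
  assumes x: "a < x" "x < b"
    and lim: "((\<lambda>x. f x - g x) \<longlongrightarrow> 0) (at_right a)"
    and f: "\<And>x. a < x \<Longrightarrow> x < b \<Longrightarrow> (f has_real_derivative f' x) (at x)"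
    and g: "\<And>x. a < x \<Longrightarrow> x < b \<Longrightarrow> (g has_real_derivative f' x) (at x)"
  shows "f x = g x"
proof -
  have "((\<lambda>x. f x - g x) has_real_derivative 0) (at y)" if "y \<in> {a<..<b}" for y
    using DERIV_diff[OF f[of y] g[of y]] that by simp
  then have "\<exists>c. \<forall>y\<in>{a<..<b}. f y - g y = c"
    by (intro has_field_derivative_zero_constant) (auto intro: has_field_derivative_at_within)
  then obtain c where c: "f y - g y = c" if "a < y" "y < b" for y by auto
  have "eventually (\<lambda>y. c = f y - g y) (at_right a)"
    using eventually_at_right_real[OF order.strict_trans[OF x]] by eventually_elim (use c in auto)
  with lim have "((\<lambda>y. c) \<longlongrightarrow> 0) (at_right a)"
    using tendsto_cong[of "\<lambda>y. c" "\<lambda>y. f y - g y" "at_right a" 0] by simp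
  then have "c = 0" by (simp add: tendsto_const_iff)
  then show ?thesis using c[OF x] by simp
qed

subsection \<open>Functional equations of di- and trilogarithms\<close>

definition Li :: "nat \<Rightarrow> real \<Rightarrow> real" where
  "Li s x = (\<Sum>n. 1 / real (Suc n) ^ s * x ^ Suc n)"

lemma Li_0 [simp]: "Li s 0 = 0"
  by (simp add: Li_def)

lemma summable_Li:
  assumes "\<bar>x\<bar> < 1"
  shows "summable (\<lambda>n. 1 / real (Suc n) ^ s * x ^ n)"
proof (rule summable_comparison_test')
  show "summable (\<lambda>n. \<bar>x\<bar> ^ n)" using assms by (simp add: summable_geometric)
  show "norm (1 / real (Suc n) ^ s * x ^ n) \<le> \<bar>x\<bar> ^ n" for n
  proof -
    have "1 \<le> real (Suc n) ^ s" by (rule one_le_power) simp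
    then have "inverse (real (Suc n) ^ s) \<le> 1" by (simp add: inverse_le_1_iff)
    then have "inverse (real (Suc n) ^ s) * \<bar>x\<bar> ^ n \<le> 1 * \<bar>x\<bar> ^ n" by (intro mult_right_mono) auto
    then show ?thesis by (simp add: abs_mult power_abs field_simps)
  qed
qed

lemma Li_Suc_has_derivative:
  assumes "\<bar>x\<bar> < 1" "x \<noteq> 0"
  shows "(Li (Suc s) has_real_derivative Li s x / x) (at x)"
proof -
  have "((\<lambda>x. \<Sum>n. 1 / real (Suc n) ^ s / Suc n * x ^ Suc n) has_real_derivative
      (\<Sum>n. 1 / real (Suc n) ^ s * x ^ n)) (at x)"
    by (rule powser_antiderivative) (use assms summable_Li in auto)
  moreover have "(\<Sum>n. 1 / real (Suc n) ^ s * x ^ n) = Li s x / x"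
    using suminf_mult[OF summable_Li[OF assms(1), of s], of x] assms
    by (simp add: Li_def mult_ac)
  ultimately show ?thesis by (simp add: Li_def[abs_def] mult_ac)
qed

text \<open>The quotient form of the derivative breaks down at 0, where the slope is the first
  coefficient of the series. \<open>tendsto_J\<close> needs this slope for
  \<open>Li 2\<close>.\<close>

lemma Li_Suc_has_derivative_0: "(Li (Suc s) has_real_derivative 1) (at 0)"
proof -
  have "((\<lambda>x. \<Sum>n. 1 / real (Suc n) ^ s / Suc n * x ^ Suc n) has_real_derivative
      (\<Sum>n. 1 / real (Suc n) ^ s * 0 ^ n)) (at 0)"
    by (rule powser_antiderivative) (use summable_Li in auto)
  then show ?thesis using powser_zero[of "\<lambda>n. 1 / real (Suc n) ^ s"]
    by (simp add: Li_def[abs_def] mult_ac)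
qed

lemma Li_1:
  assumes "\<bar>x\<bar> < 1"
  shows "Li 1 x = - ln (1 - x)"
proof -
  have D: "(Li 1 has_real_derivative 1 / (1 - y)) (at y)" if "\<bar>y\<bar> < 1" for y
  proof -
    have "((\<lambda>x. \<Sum>n. 1 / Suc n * x ^ Suc n) has_real_derivative 1 / (1 - y)) (at y)"
      by (rule powser_antiderivative) (use that geometric_sums[where 'a = real] in simp_all)
    then show ?thesis by (simp add: Li_def[abs_def])
  qed
  have E: "((\<lambda>x. - ln (1 - x)) has_real_derivative 1 / (1 - y)) (at y)" if "\<bar>y\<bar> < 1" for y
    using that by (auto intro!: derivative_eq_intros simp: divide_simps)
  have "((\<lambda>x. Li 1 x + ln (1 - x)) has_real_derivative 0) (at y)" if "\<bar>y\<bar> < 1" for y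
    using DERIV_diff[OF D E, OF that that] by simp
  then have "\<exists>c. \<forall>y\<in>{-1<..<1}. Li 1 y + ln (1 - y) = c"
    by (intro has_field_derivative_zero_constant)
       (auto intro: has_field_derivative_at_within simp: abs_less_iff)
  then obtain c where c: "Li 1 y + ln (1 - y) = c" if "\<bar>y\<bar> < 1" for y
    by (auto simp: abs_less_iff)
  show ?thesis using c[of 0] c[OF assms] by simp
qed

lemma summable_recip_power:
  assumes "s \<ge> 2"
  shows "summable (\<lambda>n. 1 / real (Suc n) ^ s)"
  using inverse_power_summable[of s] assms summable_Suc_iff[of "\<lambda>n. inverse (real n ^ s)"]
  by (simp add: inverse_eq_divide)

lemma Li_term_le:
  fixes x :: real
  assumes "\<bar>x\<bar> \<le> 1"
  shows "norm (1 / real (Suc n) ^ s * x ^ Suc n) \<le> 1 / real (Suc n) ^ s"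
proof -
  have "\<bar>x\<bar> ^ Suc n \<le> 1" by (intro power_le_one) (use assms in auto)
  then have "1 / real (Suc n) ^ s * \<bar>x\<bar> ^ Suc n \<le> 1 / real (Suc n) ^ s * 1"
    by (intro mult_left_mono) auto
  then show ?thesis by (simp add: abs_mult power_abs)
qed

text \<open>By the Weierstrass test convergence is uniform up to the endpoints. This makes the
  values at 1 and -1 available as limits, while the derivative rules hold only inside.\<close>

lemma continuous_on_Li:
  assumes "s \<ge> 2"
  shows "continuous_on {-1..1} (Li s)"
proof -
  have "uniform_limit {-1..1} (\<lambda>n x. \<Sum>i<n. 1 / real (Suc i) ^ s * x ^ Suc i)
      (\<lambda>x. \<Sum>i. 1 / real (Suc i) ^ s * x ^ Suc i) sequentially"
    by (rule Weierstrass_m_test[OF Li_term_le summable_recip_power[OF assms]]) auto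
  then show ?thesis
    unfolding Li_def[abs_def]
    by (rule uniform_limit_theorem[rotated]) (auto intro!: always_eventually continuous_intros)
qed

lemma Li_sums:
  assumes "s \<ge> 2" "\<bar>x\<bar> \<le> 1"
  shows "(\<lambda>n. 1 / real (Suc n) ^ s * x ^ Suc n) sums Li s x"
proof -
  have "summable (\<lambda>n. 1 / real (Suc n) ^ s * x ^ Suc n)"
    by (rule summable_comparison_test'[OF summable_recip_power[OF assms(1)] Li_term_le[OF assms(2)]])
  then show ?thesis by (simp add: Li_def summable_sums)
qed

text \<open>In the sum of the series at \<open>x\<close> and \<open>- x\<close> the odd powers
  cancel and the even ones double; the denominators of the latter supply the power of 2.\<close>

lemma Li_duplication:
  assumes "s \<ge> 2" "\<bar>x\<bar> \<le> 1"
  shows "Li s (x\<^sup>2) = 2 ^ (s - 1) * (Li s x + Li s (- x))"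
proof -
  let ?f = "\<lambda>n. 1 / real (Suc n) ^ s * x ^ Suc n + 1 / real (Suc n) ^ s * (- x) ^ Suc n"
  have f: "?f sums (Li s x + Li s (- x))"
    using assms by (intro sums_add Li_sums) auto
  \<comment> \<open>The term of index \<open>n\<close> carries the power \<open>Suc n\<close>, so
    the even powers sit at the odd indices.\<close>
  have "(\<lambda>n. ?f (2 * n + 1)) sums (Li s x + Li s (- x)) \<longleftrightarrow> ?f sums (Li s x + Li s (- x))"
  proof (rule sums_mono_reindex)
    show "strict_mono (\<lambda>n::nat. 2 * n + 1)" by (simp add: strict_mono_def)
    fix n :: nat assume n: "n \<notin> range (\<lambda>n. 2 * n + 1)"
    then have "even n" by (metis oddE rangeI)
    then show "?f n = 0" by simp
  qed
  with f have "(\<lambda>n. 2 ^ (s - 1) * ?f (2 * n + 1)) sums (2 ^ (s - 1) * (Li s x + Li s (- x)))"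
    by (intro sums_mult) simp
  moreover have "2 ^ (s - 1) * ?f (2 * n + 1) = 1 / real (Suc n) ^ s * (x\<^sup>2) ^ Suc n" for n
  proof -
    have "real (Suc (2 * n + 1)) = 2 * real (Suc n)" by simp
    moreover have "(2::real) ^ s = 2 * 2 ^ (s - 1)" using assms by (cases s) auto
    moreover have "x ^ Suc (2 * n + 1) = (x\<^sup>2) ^ Suc n" "(- x) ^ Suc (2 * n + 1) = (x\<^sup>2) ^ Suc n"
      by (simp_all add: power_mult flip: power_Suc power_mult)
    ultimately show ?thesis by (simp only: power_mult_distrib) (simp add: divide_simps)
  qed
  ultimately have "(\<lambda>n. 1 / real (Suc n) ^ s * (x\<^sup>2) ^ Suc n) sums (2 ^ (s - 1) * (Li s x + Li s (- x)))"
    by simp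
  moreover have "\<bar>x\<^sup>2\<bar> \<le> 1" using assms by (simp add: abs_square_le_1)
  ultimately show ?thesis using Li_sums[OF assms(1), of "x\<^sup>2"] sums_unique2 by blast
qed

lemma Li_3_1: "Li 3 1 = zeta 3"
  unfolding Li_def zeta_def
proof (rule suminf_cong)
  fix n
  have "real (Suc n) powr (real 3) = real (Suc n) ^ 3" by (rule powr_realpow) simp
  then show "1 / real (Suc n) ^ 3 * 1 ^ Suc n = 1 / real (Suc n) powr 3" by simp
qed

lemma Li_minus_1:
  "Li 2 (-1) = - Li 2 1 / 2" "Li 3 (-1) = - 3 / 4 * Li 3 1"
  using Li_duplication[of 2 1] Li_duplication[of 3 1] by simp_all


lemma DERIV_Li [derivative_intros]:
  assumes "(g has_real_derivative g') (at x)" "\<bar>g x\<bar> < 1" "g x \<noteq> 0"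
  shows "((\<lambda>x. Li 2 (g x)) has_real_derivative - ln (1 - g x) / g x * g') (at x)"
    and "((\<lambda>x. Li 3 (g x)) has_real_derivative Li 2 (g x) / g x * g') (at x)"
  using DERIV_chain2[OF Li_Suc_has_derivative[of "g x" 1] assms(1)]
    DERIV_chain2[OF Li_Suc_has_derivative[of "g x" 2] assms(1)] assms(2,3) Li_1
  by (simp_all add: numeral_2_eq_2 numeral_3_eq_3)

lemma tendsto_Li:
  assumes g: "(g \<longlongrightarrow> l) F" and "\<bar>l\<bar> \<le> 1" "eventually (\<lambda>x. \<bar>g x\<bar> \<le> 1) F" "s \<ge> 2"
  shows "((\<lambda>x. Li s (g x)) \<longlongrightarrow> Li s l) F"
  by (rule continuous_on_tendsto_compose[OF continuous_on_Li g])
    (use assms in \<open>auto elim!: eventually_mono simp: abs_le_iff\<close>)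

lemma tendsto_Li_at_right_0:
  assumes "(g \<longlongrightarrow> l) (at_right 0)" "\<bar>l\<bar> \<le> 1" "\<And>x. 0 < x \<Longrightarrow> x < 1 \<Longrightarrow> \<bar>g x\<bar> \<le> 1" "s \<ge> 2"
  shows "((\<lambda>x. Li s (g x)) \<longlongrightarrow> Li s l) (at_right (0::real))"
  using assms(1,2) _ assms(4)
proof (rule tendsto_Li)
  show "eventually (\<lambda>x. \<bar>g x\<bar> \<le> 1) (at_right 0)"
    using eventually_at_right_real[OF zero_less_one] by eventually_elim (use assms(3) in auto)
qed

section \<open>Reflection, Landen and Spence equations\<close>

lemma Li_2_reflection:
  assumes "0 < x" "x < 1"
  shows "Li 2 x + Li 2 (1 - x) = Li 2 1 - ln x * ln (1 - x)"
proof (rule eq_if_same_derivative[of 0 x 1])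
  have "((\<lambda>x. Li 2 x + Li 2 (1 - x) - (Li 2 1 - ln x * ln (1 - x))) \<longlongrightarrow> Li 2 0 + Li 2 1 - (Li 2 1 - 0))
      (at_right 0)"
    by (intro tendsto_intros tendsto_Li_at_right_0) (auto intro: tendsto_eq_intros, real_asymp+)
  then show "((\<lambda>x. Li 2 x + Li 2 (1 - x) - (Li 2 1 - ln x * ln (1 - x))) \<longlongrightarrow> 0) (at_right 0)"
    by simp
  fix x :: real assume x: "0 < x" "x < 1"
  show "((\<lambda>x. Li 2 x + Li 2 (1 - x)) has_real_derivative ln x / (1 - x) - ln (1 - x) / x) (at x)"
    using x by (auto intro!: derivative_eq_intros simp: divide_simps)
  show "((\<lambda>x. Li 2 1 - ln x * ln (1 - x)) has_real_derivative ln x / (1 - x) - ln (1 - x) / x) (at x)"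
    using x by (auto intro!: derivative_eq_intros simp: divide_simps)
qed (use assms in auto)

text \<open>Since \<open>1 - x / (1 + x) = 1 / (1 + x)\<close>, the derivatives of both dilogarithms
  involve no logarithm other than \<open>ln (1 + x)\<close>.\<close>

lemma Li_2_Landen:
  assumes "0 < x" "x < 1"
  shows "Li 2 (x / (1 + x)) + Li 2 (- x) = - (ln (1 + x))\<^sup>2 / 2"
proof (rule eq_if_same_derivative[of 0 x 1])
  have "((\<lambda>x. Li 2 (x / (1 + x)) + Li 2 (- x) - - (ln (1 + x))\<^sup>2 / 2) \<longlongrightarrow> Li 2 0 + Li 2 0 - 0) (at_right 0)"
    by (intro tendsto_intros tendsto_Li_at_right_0) (auto intro: tendsto_eq_intros simp: divide_simps, real_asymp+)
  then show "((\<lambda>x. Li 2 (x / (1 + x)) + Li 2 (- x) - - (ln (1 + x))\<^sup>2 / 2) \<longlongrightarrow> 0) (at_right 0)"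
    by simp
  fix x :: real assume x: "0 < x" "x < 1"
  have l: "ln (1 - x / (1 + x)) = - ln (1 + x)"
  proof -
    have "1 - x / (1 + x) = inverse (1 + x)" using x by (simp add: field_simps)
    then show ?thesis using x by (simp add: ln_inverse)
  qed
  show "((\<lambda>x. Li 2 (x / (1 + x)) + Li 2 (- x)) has_real_derivative - ln (1 + x) / (1 + x)) (at x)"
    using x by (auto intro!: derivative_eq_intros simp: l) (simp add: divide_simps, simp add: algebra_simps power2_eq_square)
  show "((\<lambda>x. - (ln (1 + x))\<^sup>2 / 2) has_real_derivative - ln (1 + x) / (1 + x)) (at x)"
    using x by (auto intro!: derivative_eq_intros simp: divide_simps)
qed (use assms in auto)

text \<open>Reflection at \<open>1 / (1 + x)\<close> followed by Landen's equation. It brings in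
  \<open>Li 2 (- x)\<close>, which cancels in the derivatives of the trilogarithm equations.\<close>

lemma Li_2_inverse_Suc:
  assumes "0 < x" "x < 1"
  shows "Li 2 (1 / (1 + x)) = Li 2 1 + ln x * ln (1 + x) - (ln (1 + x))\<^sup>2 / 2 + Li 2 (- x)"
proof -
  have "1 - 1 / (1 + x) = x / (1 + x)" using assms by (simp add: field_simps)
  then have "Li 2 (1 / (1 + x)) = Li 2 1 - ln (1 / (1 + x)) * ln (x / (1 + x)) - Li 2 (x / (1 + x))"
    using Li_2_reflection[of "1 / (1 + x)"] assms by simp
  also have "Li 2 (x / (1 + x)) = - (ln (1 + x))\<^sup>2 / 2 - Li 2 (- x)"
    using Li_2_Landen[OF assms] by simp
  finally show ?thesis using assms by (simp add: ln_div power2_eq_square algebra_simps)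
qed

text \<open>In the derivative, the dilogarithm equations leave \<open>Li 2 (- x)\<close> with the
  coefficients \<open>- 1 / (1 + x)\<close>, \<open>1 / (1 + x) - 1 / x\<close> and
  \<open>1 / x\<close>, which add up to 0. Only logarithms and the constant \<open>Li 2 1\<close>
  remain.\<close>

lemma Li_3_Landen:
  assumes "0 < x" "x < 1"
  shows "Li 3 (1 / (1 + x)) + Li 3 (x / (1 + x)) + Li 3 (- x) =
    Li 3 1 - Li 2 1 * ln (1 + x) + ln (1 + x) ^ 3 / 3 - (ln (1 + x))\<^sup>2 * ln x / 2" (is "?f x = ?g x")
proof (rule eq_if_same_derivative[of 0 x 1 ?f ?g])
  have "((\<lambda>x. ?f x - ?g x) \<longlongrightarrow> Li 3 1 + Li 3 0 + Li 3 0 - (Li 3 1 - 0 + 0 - 0)) (at_right 0)"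
    by (intro tendsto_intros tendsto_Li_at_right_0)
      (auto intro: tendsto_eq_intros simp: divide_simps, real_asymp+)
  then show "((\<lambda>x. ?f x - ?g x) \<longlongrightarrow> 0) (at_right 0)"
    by simp
  fix x :: real assume x: "0 < x" "x < 1"
  have l: "Li 2 (x / (1 + x)) = - (ln (1 + x))\<^sup>2 / 2 - Li 2 (- x)"
    using Li_2_Landen[OF x] by simp
  show "(?g has_real_derivative - Li 2 1 / (1 + x) + (ln (1 + x))\<^sup>2 / (1 + x) - ln (1 + x) * ln x / (1 + x)
      - (ln (1 + x))\<^sup>2 / (2 * x)) (at x)"
    using x by (auto intro!: derivative_eq_intros simp: divide_simps) (simp add: algebra_simps power2_eq_square)
  show "(?f has_real_derivative - Li 2 1 / (1 + x) + (ln (1 + x))\<^sup>2 / (1 + x) - ln (1 + x) * ln x / (1 + x)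
      - (ln (1 + x))\<^sup>2 / (2 * x)) (at x)"
    using x by (auto intro!: derivative_eq_intros simp: l Li_2_inverse_Suc)
      (simp add: divide_simps, simp add: algebra_simps power2_eq_square)
qed (use assms in auto)

text \<open>For \<open>y = (1 - x) / (1 + x)\<close> the logarithms of \<open>1 - y\<close> and
  \<open>1 + y\<close> differ by \<open>ln x\<close>, so the derivative of the left side is simple.
  The equation handles the first two terms of \<open>Li_3_Spence\<close>.\<close>

lemma Li_2_Spence:
  assumes "0 < x" "x < 1"
  shows "Li 2 ((1 - x) / (1 + x)) - Li 2 (- ((1 - x) / (1 + x))) =
    Li 2 (1 - x) + Li 2 (- x) + ln x * ln (1 + x) + Li 2 1 / 2" (is "?f x = ?g x")
proof (rule eq_if_same_derivative[of 0 x 1 ?f ?g])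
  have "((\<lambda>x. ?f x - ?g x) \<longlongrightarrow> Li 2 1 - Li 2 (-1) - (Li 2 1 + Li 2 0 + 0 + Li 2 1 / 2)) (at_right 0)"
    by (intro tendsto_intros tendsto_Li_at_right_0)
      (auto intro: tendsto_eq_intros simp: divide_simps, real_asymp+)
  then show "((\<lambda>x. ?f x - ?g x) \<longlongrightarrow> 0) (at_right 0)"
    by (simp add: Li_minus_1)
  fix x :: real assume x: "0 < x" "x < 1"
  have "1 - (1 - x) / (1 + x) = 2 * x / (1 + x)" "1 + (1 - x) / (1 + x) = 2 / (1 + x)"
    using x by (simp_all add: field_simps)
  then have l: "ln (1 - (1 - x) / (1 + x)) = ln 2 + ln x - ln (1 + x)"
    "ln (1 + (1 - x) / (1 + x)) = ln 2 - ln (1 + x)"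
    using x by (simp_all add: ln_div ln_mult)
  show "(?g has_real_derivative ln x / (1 - x) + ln x / (1 + x)) (at x)"
    using x by (auto intro!: derivative_eq_intros simp: divide_simps) (simp add: algebra_simps power2_eq_square)
  show "(?f has_real_derivative ln x / (1 - x) + ln x / (1 + x)) (at x)"
    using x by (auto intro!: derivative_eq_intros simp: l)
      (simp_all add: divide_simps, simp_all add: algebra_simps power2_eq_square)
qed (use assms in auto)

text \<open>After differentiation the equations above express every dilogarithm through
  \<open>Li 2 x\<close>, \<open>Li 2 (- x)\<close>, \<open>Li 2 1\<close> and logarithms, and the
  first two drop out.\<close>

lemma Li_3_Spence:
  assumes "0 < x" "x < 1"
  shows "Li 3 ((1 - x) / (1 + x)) - Li 3 (- ((1 - x) / (1 + x))) - 2 * Li 3 (1 - x)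
      - 2 * Li 3 (1 / (1 + x)) + Li 3 (1 - x\<^sup>2) / 2 =
    Li 2 1 * ln (1 + x) - ln (1 + x) ^ 3 / 3 - 7 / 4 * Li 3 1" (is "?f x = ?g x")
proof (rule eq_if_same_derivative[of 0 x 1 ?f ?g])
  have "((\<lambda>x. ?f x - ?g x) \<longlongrightarrow> (Li 3 1 - Li 3 (-1) - 2 * Li 3 1 - 2 * Li 3 1 + Li 3 1 / 2)
      - (0 - 0 - 7 / 4 * Li 3 1)) (at_right 0)"
    by (intro tendsto_intros tendsto_Li_at_right_0)
      (auto intro: tendsto_eq_intros simp: divide_simps abs_square_le_1 power_le_one, real_asymp+)
  then show "((\<lambda>x. ?f x - ?g x) \<longlongrightarrow> 0) (at_right 0)"
    by (simp add: Li_minus_1)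
  fix x :: real assume x: "0 < x" "x < 1"
  have x2: "0 < x\<^sup>2" "x\<^sup>2 < 1" "0 < 1 - x\<^sup>2" using x by (auto simp: power_less_one_iff)
  have "1 - x\<^sup>2 = (1 - x) * (1 + x)" by (simp add: power2_eq_square algebra_simps)
  then have "ln (1 - x\<^sup>2) = ln (1 - x) + ln (1 + x)" using x by (simp add: ln_mult)
  then have sq: "Li 2 (1 - x\<^sup>2) = Li 2 1 - 2 * ln x * (ln (1 - x) + ln (1 + x)) - 2 * (Li 2 x + Li 2 (- x))"
    using Li_2_reflection[OF x2(1,2)] Li_duplication[of 2 x] x by (simp add: ln_realpow)
  have rf: "Li 2 (1 - x) = Li 2 1 - ln x * ln (1 - x) - Li 2 x"
    using Li_2_reflection[OF x] by simp
  note sp = Li_2_Spence[OF x]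
  \<comment> \<open>The cancellation as pure algebra: \<open>a\<close>, \<open>b\<close>,
    \<open>c\<close> stand for the logarithms of \<open>x\<close>, \<open>1 - x\<close>,
    \<open>1 + x\<close>; \<open>p\<close>, \<open>q\<close>, \<open>z\<close> for
    \<open>Li 2\<close> at \<open>x\<close>, \<open>- x\<close>, 1; and \<open>r\<close>,
    \<open>t\<close> for \<open>1 / (1 - x)\<close>, \<open>1 / (1 + x)\<close>.\<close>
  have id: "(z - a * b - p + q + a * c + z / 2) * - (r + t) - 2 * (- (z - a * b - p) * r)
      - 2 * (- (z + a * c - c\<^sup>2 / 2 + q) * t) + (z - 2 * a * (b + c) - 2 * (p + q)) * (t - r) / 2
      = (z - c\<^sup>2) * t" for a b c p q r t z :: real
    by (simp add: field_simps)
  show "(?g has_real_derivative (Li 2 1 - (ln (1 + x))\<^sup>2) / (1 + x)) (at x)"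
    using x by (auto intro!: derivative_eq_intros simp: divide_simps) (simp add: algebra_simps)
  have y: "((\<lambda>x. (1 - x) / (1 + x)) has_real_derivative - 2 / (1 + x)\<^sup>2) (at x)"
    using x by (auto intro!: derivative_eq_intros simp: power2_eq_square)
  have y': "\<bar>(1 - x) / (1 + x)\<bar> < 1" "(1 - x) / (1 + x) \<noteq> 0" using x by auto
  define r t where "r = 1 / (1 - x)" and "t = 1 / (1 + x)"
  have D1: "((\<lambda>x. Li 3 ((1 - x) / (1 + x)) - Li 3 (- ((1 - x) / (1 + x)))) has_real_derivative
     (Li 2 ((1 - x) / (1 + x)) - Li 2 (- ((1 - x) / (1 + x)))) * - (r + t)) (at x)"
    unfolding r_def t_def
    by (rule derivative_eq_intros y y' refl | use y' in simp; fail)+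
      (use x in \<open>simp add: divide_simps, simp add: algebra_simps power2_eq_square\<close>)
  have D2: "((\<lambda>x. Li 3 (1 - x)) has_real_derivative - Li 2 (1 - x) * r) (at x)"
    using x by (auto intro!: derivative_eq_intros simp: r_def)
  have D3: "((\<lambda>x. Li 3 (1 / (1 + x))) has_real_derivative - Li 2 (1 / (1 + x)) * t) (at x)"
    using x by (auto intro!: derivative_eq_intros simp: t_def divide_simps)
  have "- (2 * x) / (1 - x\<^sup>2) = t - r"
    using x x2 unfolding r_def t_def by (simp add: divide_simps) (simp add: algebra_simps power2_eq_square)
  then have "Li 2 (1 - x\<^sup>2) / (1 - x\<^sup>2) * - (2 * x) = Li 2 (1 - x\<^sup>2) * (t - r)"
    by (metis times_divide_eq_left times_divide_eq_right)
  moreover have "((\<lambda>x. Li 3 (1 - x\<^sup>2)) has_real_derivative Li 2 (1 - x\<^sup>2) / (1 - x\<^sup>2) * - (2 * x)) (at x)"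
    by (rule DERIV_Li(2)) (use x2 in \<open>auto intro!: derivative_eq_intros\<close>)
  ultimately have D4: "((\<lambda>x. Li 3 (1 - x\<^sup>2)) has_real_derivative Li 2 (1 - x\<^sup>2) * (t - r)) (at x)"
    by simp
  have "(Li 2 ((1 - x) / (1 + x)) - Li 2 (- ((1 - x) / (1 + x)))) * - (r + t) - 2 * (- Li 2 (1 - x) * r)
      - 2 * (- Li 2 (1 / (1 + x)) * t) + Li 2 (1 - x\<^sup>2) * (t - r) / 2 = (Li 2 1 - (ln (1 + x))\<^sup>2) * t"
    unfolding sp sq rf Li_2_inverse_Suc[OF x] by (rule id)
  with DERIV_add[OF DERIV_diff[OF DERIV_diff[OF D1 DERIV_cmult[OF D2, of 2]] DERIV_cmult[OF D3, of 2]]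
      DERIV_cdivide[OF D4, of 2]]
  show "(?f has_real_derivative (Li 2 1 - (ln (1 + x))\<^sup>2) / (1 + x)) (at x)"
    by (simp add: t_def)
qed (use assms in auto)

text \<open>The second value is Landen's equation at \<open>x = 1\<close>, where two arguments
  become 1/2. As \<open>Li_3_Landen\<close> is stated for \<open>x < 1\<close>, both sides are taken
  to the limit.\<close>

lemma Li_half:
  "Li 2 (1 / 2) = Li 2 1 / 2 - (ln 2)\<^sup>2 / 2"
  "Li 3 (1 / 2) = 7 / 8 * Li 3 1 - Li 2 1 * ln 2 / 2 + ln 2 ^ 3 / 6"
proof -
  show "Li 2 (1 / 2) = Li 2 1 / 2 - (ln 2)\<^sup>2 / 2"
    using Li_2_reflection[of "1 / 2"] by (simp add: ln_div power2_eq_square)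
  let ?f = "\<lambda>x. Li 3 (1 / (1 + x)) + Li 3 (x / (1 + x)) + Li 3 (- x)"
  let ?g = "\<lambda>x. Li 3 1 - Li 2 1 * ln (1 + x) + ln (1 + x) ^ 3 / 3 - (ln (1 + x))\<^sup>2 * ln x / 2"
  have ev: "eventually (\<lambda>x. 0 < x \<and> x < 1) (at_left (1::real))"
    using eventually_at_left_real[OF zero_less_one] by eventually_elim auto
  have "(?f \<longlongrightarrow> Li 3 (1 / 2) + Li 3 (1 / 2) + Li 3 (-1)) (at_left 1)"
    by (intro tendsto_intros tendsto_Li)
      (auto intro!: tendsto_eq_intros eventually_mono[OF ev] simp: divide_simps)
  moreover have "(?g \<longlongrightarrow> Li 3 1 - Li 2 1 * ln 2 + ln 2 ^ 3 / 3 - 0) (at_left 1)"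
    by (auto intro!: tendsto_eq_intros)
  moreover have "eventually (\<lambda>x. ?f x = ?g x) (at_left 1)"
    using ev by eventually_elim (use Li_3_Landen in blast)
  ultimately have "Li 3 (1 / 2) + Li 3 (1 / 2) + Li 3 (-1) = Li 3 1 - Li 2 1 * ln 2 + ln 2 ^ 3 / 3 - 0"
    using tendsto_unique[OF trivial_limit_at_left_real] tendsto_cong[of ?f ?g] by blast
  then show "Li 3 (1 / 2) = 7 / 8 * Li 3 1 - Li 2 1 * ln 2 / 2 + ln 2 ^ 3 / 6"
    by (simp add: Li_minus_1)
qed


subsection \<open>The value \<open>J(1/2)\<close>\<close>

text \<open>Closed forms of \<open>\<integral> (ln (1 - u))\<^sup>2 / u du\<close> and \<open>\<integral> (ln (1 + u))\<^sup>2 / u du\<close> on \<open>(0, 1)\<close> that vanish at 0.\<close>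

definition sq_log_integral :: "real \<Rightarrow> real" where
  "sq_log_integral u = ln u * (ln (1 - u))\<^sup>2 + 2 * ln (1 - u) * Li 2 (1 - u) - 2 * Li 3 (1 - u) + 2 * Li 3 1"

definition sq_log1p_integral :: "real \<Rightarrow> real" where
  "sq_log1p_integral u = ln u * (ln (1 + u))\<^sup>2 - 2 / 3 * ln (1 + u) ^ 3
     - 2 * ln (1 + u) * Li 2 (1 / (1 + u)) - 2 * Li 3 (1 / (1 + u)) + 2 * Li 3 1"

text \<open>
  The product \<open>ln (1 - v) ln (1 + v)\<close> in \<open>J'\<close> is split by polarization into the squares of \<open>ln (1 - v\<^sup>2)\<close>,
  \<open>ln (1 - v)\<close> and \<open>ln (1 + v)\<close>.
\<close>

definition J :: "real \<Rightarrow> real" where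
  "J v = ln v * Li 2 (- v) - Li 3 (- v)
     + sq_log_integral (v\<^sup>2) / 4 - sq_log_integral v / 2 - sq_log1p_integral v / 2"

lemma DERIV_sq_log_integral:
  assumes "0 < u" "u < 1"
  shows "(sq_log_integral has_real_derivative (ln (1 - u))\<^sup>2 / u) (at u)"
  unfolding sq_log_integral_def[abs_def] using assms
  by (auto intro!: derivative_eq_intros simp: divide_simps) (simp add: algebra_simps power2_eq_square)

lemma DERIV_sq_log1p_integral:
  assumes "0 < u" "u < 1"
  shows "(sq_log1p_integral has_real_derivative (ln (1 + u))\<^sup>2 / u) (at u)"
proof -
  have l: "ln (1 - 1 / (1 + u)) = ln u - ln (1 + u)"
  proof -
    have "1 - 1 / (1 + u) = u / (1 + u)" using assms by (simp add: field_simps)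
    then show ?thesis using assms by (simp add: ln_div)
  qed
  show ?thesis
    unfolding sq_log1p_integral_def[abs_def] using assms
    by (auto intro!: derivative_eq_intros simp: l ln_div divide_simps) (simp add: algebra_simps power2_eq_square)
qed

text \<open>The chain rule for \<open>v\<^sup>2\<close> contributes a factor 2, so the weight 1/4 in
  \<open>J\<close> matches the weights 1/2 of the other two squares.\<close>

lemma DERIV_J:
  assumes "0 < v" "v < 1"
  shows "(J has_real_derivative (ln (1 - v) - ln v) * ln (1 + v) / v) (at v)"
proof -
  have v2: "0 < v\<^sup>2" "v\<^sup>2 < 1" using assms by (auto simp: power_less_one_iff)
  have "1 - v\<^sup>2 = (1 - v) * (1 + v)" by (simp add: power2_eq_square algebra_simps)
  then have l: "ln (1 - v\<^sup>2) = ln (1 - v) + ln (1 + v)" using assms by (simp add: ln_mult)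
  \<comment> \<open>The two contributions \<open>Li 2 (- v) / v\<close> cancel, leaving the
    \<open>ln v\<close> part of the integrand.\<close>
  have D1: "((\<lambda>v. ln v * Li 2 (- v) - Li 3 (- v)) has_real_derivative - (ln v * ln (1 + v) / v)) (at v)"
    using assms by (auto intro!: derivative_eq_intros simp: divide_simps)
  have "((\<lambda>v. sq_log_integral (v\<^sup>2)) has_real_derivative (ln (1 - v\<^sup>2))\<^sup>2 / v\<^sup>2 * (2 * v)) (at v)"
    by (rule DERIV_chain2[where g = "\<lambda>v. v\<^sup>2" and x = v, OF DERIV_sq_log_integral[OF v2]]) (auto intro!: derivative_eq_intros)
  from DERIV_diff[OF DERIV_diff[OF DERIV_add[OF D1 DERIV_cdivide[OF this, of 4]]
      DERIV_cdivide[OF DERIV_sq_log_integral[OF assms], of 2]]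
      DERIV_cdivide[OF DERIV_sq_log1p_integral[OF assms], of 2]]
  show ?thesis
    unfolding J_def[abs_def]
    by (rule DERIV_cong) (use assms in \<open>simp add: l divide_simps, simp add: algebra_simps power2_eq_square\<close>)
qed

lemma tendsto_J: "(J \<longlongrightarrow> 0) (at_right 0)"
proof -
  \<comment> \<open>The product \<open>ln v * Li 2 (- v)\<close> is of type infinity times 0. It is
    split into \<open>ln v * - v\<close> and a difference quotient of \<open>Li 2\<close> at 0,
    which tends to 1.\<close>
  have "((\<lambda>v. (Li (Suc 1) (0 + - v) - Li (Suc 1) 0) / - v) \<longlongrightarrow> 1) (at_right 0)"
  proof (rule filterlim_compose[where f = uminus])
    show "((\<lambda>h. (Li (Suc 1) (0 + h) - Li (Suc 1) 0) / h) \<longlongrightarrow> 1) (at 0)"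
      using Li_Suc_has_derivative_0[of 1] by (simp only: DERIV_def)
    show "filterlim uminus (at 0) (at_right (0::real))" by real_asymp
  qed
  then have "((\<lambda>v. (ln v * - v) * (Li 2 (- v) / - v)) \<longlongrightarrow> 0 * 1) (at_right 0)"
    by (intro tendsto_mult) (real_asymp, simp add: numeral_2_eq_2)
  moreover have "eventually (\<lambda>v. (ln v * - v) * (Li 2 (- v) / - v) = ln v * Li 2 (- v)) (at_right 0)"
    using eventually_at_right_real[OF zero_less_one] by eventually_elim auto
  ultimately have 1: "((\<lambda>v. ln v * Li 2 (- v)) \<longlongrightarrow> 0) (at_right 0)"
    using Lim_transform_eventually[of _ 0 "at_right 0" "\<lambda>v. ln v * Li 2 (- v)"] by (simp only: mult_zero_left)
  have 2: "((\<lambda>v. Li 3 (- v)) \<longlongrightarrow> Li 3 0) (at_right 0)"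
    by (rule tendsto_Li_at_right_0) (auto intro!: tendsto_eq_intros)
  have "(sq_log_integral \<longlongrightarrow> 0 + 2 * 0 * Li 2 1 - 2 * Li 3 1 + 2 * Li 3 1) (at_right 0)"
    unfolding sq_log_integral_def
    by (intro tendsto_intros tendsto_Li_at_right_0) (real_asymp | simp)+
  then have 3: "(sq_log_integral \<longlongrightarrow> 0) (at_right 0)" by simp
  have 4: "((\<lambda>v. sq_log_integral (v\<^sup>2)) \<longlongrightarrow> 0) (at_right 0)"
    by (rule filterlim_compose[OF 3]) real_asymp
  have "(sq_log1p_integral \<longlongrightarrow> 0 - 2 / 3 * 0 - 2 * 0 * Li 2 1 - 2 * Li 3 1 + 2 * Li 3 1) (at_right 0)"
    unfolding sq_log1p_integral_def
    by (intro tendsto_intros tendsto_Li_at_right_0)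
      (real_asymp | simp add: divide_simps)+
  then have 5: "(sq_log1p_integral \<longlongrightarrow> 0) (at_right 0)" by simp
  have "((\<lambda>v. J v) \<longlongrightarrow> 0 - Li 3 0 + 0 / 4 - 0 / 2 - 0 / 2) (at_right 0)"
    unfolding J_def by (intro tendsto_intros 1 2 3 4 5) auto
  then show ?thesis by simp
qed

lemma J_half: "J (1 / 2) = 13 / 24 * zeta 3"
proof -
  define l t where "l = ln (2::real)" and "t = ln (3::real)"
  have ln: "ln (3 / 2) = t - l" "ln (4 / 3) = 2 * l - t" "ln (1 / 2) = - l" "ln (1 / 3) = - t"
    "ln (1 / 4) = - 2 * l" "ln (3 / 4) = t - 2 * l" "ln 2 = l" "ln 3 = t"
    using ln_mult[of 2 "2::real"] by (simp_all add: ln_div l_def t_def)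
  \<comment> \<open>The dilogarithm values \<open>q\<close> and \<open>z2\<close> cancel in the end,
    so neither has to be evaluated.\<close>
  define q z2 z3 where "q = Li 2 (- 1 / 2)" and "z2 = Li 2 1" and "z3 = Li 3 1"
  have p4: "Li 2 (1 / 4) = 2 * (Li 2 (1 / 2) + q)" "Li 3 (1 / 4) = 4 * (Li 3 (1 / 2) + Li 3 (- 1 / 2))"
    using Li_duplication[of 2 "1 / 2"] Li_duplication[of 3 "1 / 2"] by (simp_all add: q_def power2_eq_square)
  have h: "Li 2 (1 / 2) = z2 / 2 - l\<^sup>2 / 2" "Li 3 (1 / 2) = 7 / 8 * z3 - z2 * l / 2 + l ^ 3 / 6"
    using Li_half by (simp_all add: l_def z2_def z3_def)
  have q3: "Li 2 (- 1 / 3) = - (2 * l - t)\<^sup>2 / 2 - Li 2 (1 / 4)"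
    using Li_2_Landen[of "1 / 3"] by (simp add: ln)
  have a: "Li 2 (3 / 4) = z2 - t * (2 * l - t) - (2 * l - t)\<^sup>2 / 2 + Li 2 (- 1 / 3)"
    using Li_2_inverse_Suc[of "1 / 3"] by (simp add: ln z2_def)
  have b: "Li 2 (2 / 3) = z2 - l * (t - l) - (t - l)\<^sup>2 / 2 + q"
    using Li_2_inverse_Suc[of "1 / 2"] by (simp add: ln z2_def q_def)
  have c: "Li 3 (3 / 4) + Li 3 (1 / 4) + Li 3 (- 1 / 3) =
      z3 - z2 * (2 * l - t) + (2 * l - t) ^ 3 / 3 + (2 * l - t)\<^sup>2 * t / 2"
    using Li_3_Landen[of "1 / 3"] by (simp add: ln z2_def z3_def)
  have d: "Li 3 (2 / 3) + Li 3 (1 / 3) + Li 3 (- 1 / 2) =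
      z3 - z2 * (t - l) + (t - l) ^ 3 / 3 + (t - l)\<^sup>2 * l / 2"
    using Li_3_Landen[of "1 / 2"] by (simp add: ln z2_def z3_def)
  have e: "Li 3 (1 / 3) - Li 3 (- 1 / 3) - 2 * Li 3 (1 / 2) - 2 * Li 3 (2 / 3) + Li 3 (3 / 4) / 2 =
      z2 * (t - l) - (t - l) ^ 3 / 3 - 7 / 4 * z3"
    using Li_3_Spence[of "1 / 2"] by (simp add: ln z2_def z3_def power2_eq_square)
  have J: "J (1 / 2) = - l * q - Li 3 (- 1 / 2)
      + (- 2 * l * (t - 2 * l)\<^sup>2 + 2 * (t - 2 * l) * Li 2 (3 / 4) - 2 * Li 3 (3 / 4) + 2 * z3) / 4
      - (- l * l\<^sup>2 - 2 * l * Li 2 (1 / 2) - 2 * Li 3 (1 / 2) + 2 * z3) / 2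
      - (- l * (t - l)\<^sup>2 - 2 / 3 * (t - l) ^ 3 - 2 * (t - l) * Li 2 (2 / 3) - 2 * Li 3 (2 / 3) + 2 * z3) / 2"
    by (simp add: J_def sq_log_integral_def sq_log1p_integral_def power2_eq_square[of "1 / 2"] ln q_def z3_def)
  have c': "Li 3 (- 1 / 3) = z3 - z2 * (2 * l - t) + (2 * l - t) ^ 3 / 3 + (2 * l - t)\<^sup>2 * t / 2
     - Li 3 (1 / 4) - Li 3 (3 / 4)" using c by linarith
  have d': "Li 3 (1 / 3) = z3 - z2 * (t - l) + (t - l) ^ 3 / 3 + (t - l)\<^sup>2 * l / 2 - Li 3 (2 / 3) - Li 3 (- 1 / 2)"
    using d by linarith
  \<comment> \<open>After the substitutions the unevaluated trilogarithms enter \<open>e\<close>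
    only as -3 times \<open>Li 3 (2 / 3) - Li 3 (- 1 / 2) - Li 3 (3 / 4) / 2\<close>, exactly the
    combination occurring in \<open>J (1 / 2)\<close>.\<close>
  have "J (1 / 2) = 13 / 24 * z3"
    using e unfolding J a b q3 c' d' p4 h
    by (simp add: field_simps power2_eq_square power3_eq_cube)
  then show ?thesis by (simp add: z3_def Li_3_1)
qed


subsection \<open>Generating functions of the triple series\<close>

text \<open>Cauchy product with the geometric series in \<open>w * x\<close>. The case
  \<open>w = 1\<close> yields the partial sums over \<open>k\<close>, and \<open>w = 1 / 3\<close>
  the weights of the sum over \<open>n\<close>.\<close>

lemma powser_convolution_geometric:
  fixes a :: "nat \<Rightarrow> real"
  assumes sums: "\<And>x. \<bar>x\<bar> < 1 \<Longrightarrow> (\<lambda>n. a n * x ^ n) sums f x"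
    and x: "\<bar>x\<bar> < 1" and w: "\<bar>w\<bar> \<le> 1"
  shows "(\<lambda>n. (\<Sum>i\<le>n. a i * w ^ (n - i)) * x ^ n) sums (f x / (1 - w * x))"
proof -
  obtain r where r: "\<bar>x\<bar> < r" "r < 1" using dense[OF x] by auto
  have "summable (\<lambda>n. a n * r ^ n)" using sums[of r] r sums_summable by auto
  from powser_insidea[OF this, of x] r have 1: "summable (\<lambda>n. norm (a n * x ^ n))" by simp
  have "\<bar>w\<bar> * \<bar>x\<bar> \<le> 1 * \<bar>x\<bar>" using w by (intro mult_right_mono) auto
  then have wx: "\<bar>w * x\<bar> < 1" using x by (simp add: abs_mult)
  then have 2: "summable (\<lambda>n. norm ((w * x) ^ n))" unfolding norm_power by (intro summable_geometric) simp
  have "(\<lambda>n. \<Sum>i\<le>n. a i * x ^ i * (w * x) ^ (n - i)) sums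
      ((\<Sum>n. a n * x ^ n) * (\<Sum>n. (w * x) ^ n))"
    by (rule Cauchy_product_sums[OF 1 2])
  moreover have "(\<Sum>i\<le>n. a i * x ^ i * (w * x) ^ (n - i)) = (\<Sum>i\<le>n. a i * w ^ (n - i)) * x ^ n" for n
    unfolding sum_distrib_right
  proof (rule sum.cong)
    fix i assume "i \<in> {..n}"
    then have "x ^ n = x ^ i * x ^ (n - i)" by (simp flip: power_add)
    then show "a i * x ^ i * (w * x) ^ (n - i) = a i * w ^ (n - i) * x ^ n"
      by (simp add: power_mult_distrib)
  qed simp
  moreover have "(\<Sum>n. a n * x ^ n) * (\<Sum>n. (w * x) ^ n) = f x / (1 - w * x)"
    using sums[OF x] suminf_geometric[of "w * x"] wx by (simp add: sums_iff)
  ultimately show ?thesis by simp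
qed

text \<open>A converse of Abel's theorem. Finite sums are bounded by \<open>G x\<close>, so letting
  \<open>x\<close> tend to 1 bounds the partial sums by \<open>s\<close>; conversely
  \<open>G x \<le> suminf g\<close> for each \<open>x\<close>.\<close>

lemma sums_at_1_if_nonneg:
  fixes g :: "nat \<Rightarrow> real"
  assumes nonneg: "\<And>n. g n \<ge> 0"
    and sums: "\<And>x. 0 < x \<Longrightarrow> x < 1 \<Longrightarrow> (\<lambda>n. g n * x ^ Suc n) sums G x"
    and lim: "(G \<longlongrightarrow> s) (at_left 1)"
  shows "g sums s"
proof -
  have ev: "eventually (\<lambda>x. x \<in> {0<..<1}) (at_left (1::real))"
    by (rule eventually_at_left_real) simp
  have le: "sum g {..<N} \<le> s" for N
  proof (rule tendsto_le[OF _ lim])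
    show "((\<lambda>x. \<Sum>n<N. g n * x ^ Suc n) \<longlongrightarrow> sum g {..<N}) (at_left 1)"
      by (rule tendsto_eq_rhs[of _ "\<Sum>n<N. g n * 1 ^ Suc n"]) (intro tendsto_intros, simp)
    show "\<forall>\<^sub>F x in at_left 1. (\<Sum>n<N. g n * x ^ Suc n) \<le> G x"
      using ev
    proof eventually_elim
      case (elim x)
      then show ?case
        using sum_le_suminf[of "\<lambda>n. g n * x ^ Suc n" "{..<N}"] sums[of x] nonneg
        by (simp add: sums_iff)
    qed
  qed simp
  have "summable g" by (rule summableI_nonneg_bounded[OF nonneg le])
  moreover have "suminf g \<le> s" using suminf_le_const[OF \<open>summable g\<close> le] .
  moreover have "s \<le> suminf g"
  proof (rule tendsto_le[OF _ tendsto_const lim])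
    show "\<forall>\<^sub>F x in at_left 1. G x \<le> suminf g"
      using ev
    proof eventually_elim
      case (elim x)
      have "g n * x ^ Suc n \<le> g n" for n
        using elim nonneg[of n] by (intro mult_left_le power_le_one) auto
      then show ?case
        using suminf_le[of "\<lambda>n. g n * x ^ Suc n" g] sums[of x] \<open>summable g\<close> elim
        by (simp add: sums_iff)
    qed
  qed simp
  ultimately show ?thesis by (simp add: sums_iff)
qed

text \<open>Zero coefficients encode the parity condition, so that power series operations run over
  all \<open>k\<close>.\<close>

definition recip_odd :: "nat \<Rightarrow> real" where
  "recip_odd k = (if odd k then 1 / k else 0)"

text \<open>The series of artanh, obtained as the odd part of \<open>Li 1\<close>.\<close>

lemma recip_odd_sums:
  assumes "\<bar>x\<bar> < 1"
  shows "(\<lambda>k. recip_odd k * x ^ k) sums ((ln (1 + x) - ln (1 - x)) / 2)"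
proof -
  have L: "(\<lambda>n. 1 / real (Suc n) ^ 1 * x ^ Suc n) sums Li 1 x" if "\<bar>x\<bar> < 1" for x
    unfolding Li_def using summable_mult[OF summable_Li[OF that, of 1], of x]
    by (intro summable_sums) (simp add: mult_ac)
  have "(\<lambda>n. (1 / real (Suc n) ^ 1 * x ^ Suc n - 1 / real (Suc n) ^ 1 * (- x) ^ Suc n) / 2)
      sums ((Li 1 x - Li 1 (- x)) / 2)"
    by (intro sums_divide sums_diff L) (use assms in auto)
  moreover have "(1 / real (Suc n) ^ 1 * x ^ Suc n - 1 / real (Suc n) ^ 1 * (- x) ^ Suc n) / 2
      = recip_odd (Suc n) * x ^ Suc n" for n
    by (cases "even n") (simp_all del: power_Suc of_nat_Suc add: recip_odd_def)
  moreover have "(Li 1 x - Li 1 (- x)) / 2 = (ln (1 + x) - ln (1 - x)) / 2"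
    using Li_1[of x] Li_1[of "- x"] assms by simp
  ultimately have "(\<lambda>n. recip_odd (Suc n) * x ^ Suc n) sums ((ln (1 + x) - ln (1 - x)) / 2)"
    by (simp only:)
  then show ?thesis
    using sums_Suc_iff[of "\<lambda>k. recip_odd k * x ^ k"] by (simp add: recip_odd_def)
qed

text \<open>Collects the terms with \<open>k + m = l\<close>, where \<open>m \<ge> 1\<close> becomes
  \<open>k < l\<close>. At \<open>l = 0\<close> the value is 0.\<close>

definition inner_coeff :: "nat \<Rightarrow> real" where
  "inner_coeff l = (\<Sum>k<l. recip_odd k) / l"

text \<open>The index is one less than the total of the triple, so one factor 1/3 of the weight
  \<open>(1 / 3) ^ (Suc n - l)\<close> moves into the denominator.\<close>

definition outer_coeff :: "nat \<Rightarrow> real" where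
  "outer_coeff n = (\<Sum>l\<le>n. inner_coeff l * (1 / 3) ^ (n - l)) / (3 * real (Suc n))"

text \<open>The function \<open>B\<close> of the outline at the top; \<open>outer_series\<close> is
  \<open>F\<close>.\<close>

definition inner_series :: "real \<Rightarrow> real" where
  "inner_series x = (\<Sum>l. inner_coeff l * x ^ l)"

definition outer_series :: "real \<Rightarrow> real" where
  "outer_series x = (\<Sum>n. outer_coeff n * x ^ Suc n)"

text \<open>Passing to partial sums of \<open>recip_odd\<close> divides the generating function by
  \<open>1 - x\<close>, and dividing the coefficients by \<open>Suc n\<close> integrates it.\<close>

lemma inner_series:
  assumes "\<bar>x\<bar> < 1"
  shows inner_series_sums: "(\<lambda>l. inner_coeff l * x ^ l) sums inner_series x"
    and DERIV_inner_series:
      "(inner_series has_real_derivative (ln (1 + x) - ln (1 - x)) / (2 * (1 - x))) (at x)"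
proof -
  have a: "(\<lambda>n. (\<Sum>k\<le>n. recip_odd k) * x ^ n) sums ((ln (1 + x) - ln (1 - x)) / (2 * (1 - x)))"
    if "\<bar>x\<bar> < 1" for x
    using powser_convolution_geometric[OF recip_odd_sums that, of 1] by simp
  have c: "(\<Sum>k\<le>n. recip_odd k) / Suc n = inner_coeff (Suc n)" for n
    by (simp add: inner_coeff_def lessThan_Suc_atMost)
  have s: "(\<lambda>l. inner_coeff l * x ^ l) sums inner_series x
      \<and> inner_series x = (\<Sum>n. inner_coeff (Suc n) * x ^ Suc n)" if "\<bar>x\<bar> < 1" for x
  proof -
    have "(\<lambda>n. inner_coeff (Suc n) * x ^ Suc n) sums (\<Sum>n. inner_coeff (Suc n) * x ^ Suc n)"
      using powser_antiderivative(1)[OF a that] unfolding c by (rule summable_sums)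
    then have "(\<lambda>l. inner_coeff l * x ^ l) sums (\<Sum>n. inner_coeff (Suc n) * x ^ Suc n)"
      using sums_Suc_iff[of "\<lambda>l. inner_coeff l * x ^ l"] by (simp add: inner_coeff_def)
    then show ?thesis by (simp add: inner_series_def sums_iff)
  qed
  show "(\<lambda>l. inner_coeff l * x ^ l) sums inner_series x" using s assms by blast
  show "(inner_series has_real_derivative (ln (1 + x) - ln (1 - x)) / (2 * (1 - x))) (at x)"
  proof (rule has_field_derivative_transform_within_open[OF powser_antiderivative(2)[OF a assms]])
    show "open {-1<..<1::real}" by simp
    show "x \<in> {-1<..<1}" using assms by auto
    show "(\<Sum>n. (\<Sum>k\<le>n. recip_odd k) / Suc n * x ^ Suc n) = inner_series x" if "x \<in> {-1<..<1}" for x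
      unfolding c using s[of x] that by auto
  qed
qed

text \<open>Convolution with ratio 1/3 gives the factor \<open>1 / (1 - x / 3)\<close>, which the
  extra 1/3 turns into \<open>1 / (3 - x)\<close>.\<close>

lemma outer_series:
  assumes "\<bar>x\<bar> < 1"
  shows outer_series_sums: "(\<lambda>n. outer_coeff n * x ^ Suc n) sums outer_series x"
    and DERIV_outer_series: "(outer_series has_real_derivative inner_series x / (3 - x)) (at x)"
proof -
  define c where "c n = (\<Sum>l\<le>n. inner_coeff l * (1 / 3) ^ (n - l)) / 3" for n
  have a: "(\<lambda>n. c n * x ^ n) sums (inner_series x / (3 - x))" if "\<bar>x\<bar> < 1" for x
  proof -
    have "inner_series x / (1 - 1 / 3 * x) / 3 = inner_series x / (3 - x)"
      using that by (simp add: field_simps)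
    then show ?thesis
      using sums_divide[OF powser_convolution_geometric[OF inner_series_sums that, of "1 / 3"], of 3]
      by (simp add: c_def)
  qed
  have c: "c n / Suc n = outer_coeff n" for n by (simp add: c_def outer_coeff_def)
  show "(\<lambda>n. outer_coeff n * x ^ Suc n) sums outer_series x"
    using powser_antiderivative(1)[OF a assms] unfolding c outer_series_def by (rule summable_sums)
  show "(outer_series has_real_derivative inner_series x / (3 - x)) (at x)"
    using powser_antiderivative(2)[OF a assms] unfolding c outer_series_def[abs_def] .
qed

lemma tendsto_inner_series_0: "(inner_series \<longlongrightarrow> 0) (at_right 0)"
proof -
  have "inner_series 0 = 0"
    using powser_zero[of inner_coeff] by (simp add: inner_series_def inner_coeff_def)
  then show ?thesis
    using DERIV_isCont[OF DERIV_inner_series[of 0]] by (auto simp: isCont_def intro: tendsto_within_subset)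
qed

text \<open>With \<open>v = (1 - x) / 2\<close>, the splitting
  \<open>ln (1 + x) = ln 2 + ln (1 - v)\<close> integrates to a logarithm and \<open>Li 2 v\<close>;
  the constants give the value 0 at 0. The closed form shows the growth near 1.\<close>

lemma inner_series_eq:
  assumes "0 < x" "x < 1"
  shows "inner_series x = (ln (1 - x))\<^sup>2 / 4 - ln 2 * ln ((1 - x) / 2) / 2 + Li 2 ((1 - x) / 2) / 2
    - (ln 2)\<^sup>2 / 2 - Li 2 (1 / 2) / 2" (is "_ = ?g x")
proof (rule eq_if_same_derivative[of 0 x 1 inner_series ?g])
  have "((\<lambda>x. inner_series x - ?g x) \<longlongrightarrow> 0 - (0 - ln 2 * ln (1 / 2) / 2 + Li 2 (1 / 2) / 2
    - (ln 2)\<^sup>2 / 2 - Li 2 (1 / 2) / 2)) (at_right 0)"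
    by (intro tendsto_intros tendsto_inner_series_0 tendsto_Li_at_right_0) (real_asymp | simp)+
  then show "((\<lambda>x. inner_series x - ?g x) \<longlongrightarrow> 0) (at_right 0)"
    by (simp add: ln_div power2_eq_square)
  fix x :: real assume x: "0 < x" "x < 1"
  show "(inner_series has_real_derivative (ln (1 + x) - ln (1 - x)) / (2 * (1 - x))) (at x)"
    using x by (intro DERIV_inner_series) auto
  have e: "1 - (1 - x) / 2 = (1 + x) / 2" by (simp add: field_simps)
  have l: "ln (1 - (1 - x) / 2) = ln (1 + x) - ln 2" unfolding e using x by (simp add: ln_div)
  show "(?g has_real_derivative (ln (1 + x) - ln (1 - x)) / (2 * (1 - x))) (at x)"
    using x by (auto intro!: derivative_eq_intros simp: l)
       (simp add: divide_simps, simp add: algebra_simps power2_eq_square)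
qed (use assms in auto)

text \<open>Integration by parts, with the antiderivative \<open>- ln ((3 - x) / 2)\<close> of
  \<open>1 / (3 - x)\<close> normalized to vanish at 1, where \<open>inner_series\<close> is
  unbounded. The remaining integral is \<open>J\<close> after substituting
  \<open>v = (1 - x) / 2\<close>.\<close>

lemma outer_series_eq:
  assumes "0 < x" "x < 1"
  shows "outer_series x = (J (1 / 2) - J ((1 - x) / 2)) / 2 - inner_series x * ln ((3 - x) / 2)"
    (is "_ = ?g x")
proof (rule eq_if_same_derivative[of 0 x 1 outer_series ?g])
  have "outer_series 0 = 0" by (simp add: outer_series_def)
  then have 1: "(outer_series \<longlongrightarrow> 0) (at_right 0)"
    using DERIV_isCont[OF DERIV_outer_series[of 0]] by (auto simp: isCont_def intro: tendsto_within_subset)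
  have "isCont J (1 / 2)" by (rule DERIV_isCont[OF DERIV_J]) auto
  then have 2: "((\<lambda>x. J ((1 - x) / 2)) \<longlongrightarrow> J (1 / 2)) (at_right 0)"
    by (rule isCont_tendsto_compose) real_asymp
  have "((\<lambda>x. outer_series x - ?g x) \<longlongrightarrow> 0 - ((J (1 / 2) - J (1 / 2)) / 2 - 0 * ln (3 / 2))) (at_right 0)"
    by (intro tendsto_intros 1 tendsto_inner_series_0 2) (real_asymp | simp)+
  then show "((\<lambda>x. outer_series x - ?g x) \<longlongrightarrow> 0) (at_right 0)" by simp
  fix x :: real assume x: "0 < x" "x < 1"
  then have x': "\<bar>x\<bar> < 1" by simp
  show "(outer_series has_real_derivative inner_series x / (3 - x)) (at x)"
    by (rule DERIV_outer_series[OF x'])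
  have v: "1 - (1 - x) / 2 = (1 + x) / 2" "1 + (1 - x) / 2 = (3 - x) / 2" by (simp_all add: field_simps)
  have "((\<lambda>x. J ((1 - x) / 2)) has_real_derivative
      (ln (1 - (1 - x) / 2) - ln ((1 - x) / 2)) * ln (1 + (1 - x) / 2) / ((1 - x) / 2) * (- 1 / 2)) (at x)"
    by (rule DERIV_chain2[where g = "\<lambda>x. (1 - x) / 2" and x = x, OF DERIV_J])
      (use x in \<open>auto intro!: derivative_eq_intros\<close>)
  then have "((\<lambda>x. J ((1 - x) / 2)) has_real_derivative
      - (ln (1 + x) - ln (1 - x)) * ln ((3 - x) / 2) / (1 - x)) (at x)"
    unfolding v by (rule DERIV_cong) (use x in \<open>simp add: ln_div divide_simps, simp add: algebra_simps\<close>)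
  note D = this DERIV_inner_series[OF x']
  show "(?g has_real_derivative inner_series x / (3 - x)) (at x)"
    by (rule derivative_eq_intros D refl | use x in simp; fail)+
      (use x in \<open>simp add: divide_simps, simp add: algebra_simps\<close>)
qed (use assms in auto)

text \<open>\<open>inner_series\<close> grows only like \<open>(ln (1 - x))\<^sup>2\<close>, while
  \<open>ln ((3 - x) / 2)\<close> vanishes linearly at 1. The boundary term disappears and half of
  \<open>J (1 / 2)\<close> remains.\<close>

lemma tendsto_outer_series: "(outer_series \<longlongrightarrow> 13 / 48 * zeta 3) (at_left 1)"
proof -
  have ev: "eventually (\<lambda>x. x \<in> {0<..<1}) (at_left (1::real))"
    by (rule eventually_at_left_real) simp
  define B where "B x = (ln (1 - x))\<^sup>2 / 4 - ln 2 * ln ((1 - x) / 2) / 2 + Li 2 ((1 - x) / 2) / 2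
    - (ln 2)\<^sup>2 / 2 - Li 2 (1 / 2) / 2" for x
  have 1: "((\<lambda>x. J ((1 - x) / 2)) \<longlongrightarrow> 0) (at_left 1)"
    by (rule filterlim_compose[OF tendsto_J]) real_asymp
  have 2: "((\<lambda>x. Li 2 ((1 - x) / 2)) \<longlongrightarrow> Li 2 0) (at_left 1)"
    by (intro tendsto_Li eventually_mono[OF ev]) (real_asymp | simp)+
  have "((\<lambda>x. ((ln (1 - x))\<^sup>2 / 4 * ln ((3 - x) / 2) - ln 2 * ln ((1 - x) / 2) / 2 * ln ((3 - x) / 2))
     + (Li 2 ((1 - x) / 2) / 2 - (ln 2)\<^sup>2 / 2 - Li 2 (1 / 2) / 2) * ln ((3 - x) / 2)) \<longlongrightarrow>
       (0 - 0) + (Li 2 0 / 2 - (ln 2)\<^sup>2 / 2 - Li 2 (1 / 2) / 2) * 0) (at_left 1)"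
    by (intro tendsto_intros 2) (real_asymp | simp)+
  then have 3: "((\<lambda>x. B x * ln ((3 - x) / 2)) \<longlongrightarrow> 0) (at_left 1)"
    by (simp add: B_def algebra_simps)
  have "((\<lambda>x. (J (1 / 2) - J ((1 - x) / 2)) / 2 - B x * ln ((3 - x) / 2)) \<longlongrightarrow>
      (J (1 / 2) - 0) / 2 - 0) (at_left 1)"
    by (intro tendsto_intros 1 3) auto
  moreover have "\<forall>\<^sub>F x in at_left 1.
      (J (1 / 2) - J ((1 - x) / 2)) / 2 - B x * ln ((3 - x) / 2) = outer_series x"
    using ev by eventually_elim (simp add: outer_series_eq inner_series_eq B_def)
  ultimately have "(outer_series \<longlongrightarrow> (J (1 / 2) - 0) / 2 - 0) (at_left 1)"
    by (rule Lim_transform_eventually)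
  then show ?thesis by (simp add: J_half)
qed

section \<open>From the generating function to the sum over triples\<close>

lemma inner_coeff_nonneg: "inner_coeff l \<ge> 0"
  by (auto simp: inner_coeff_def recip_odd_def intro!: divide_nonneg_nonneg sum_nonneg)

lemma outer_coeff_nonneg: "outer_coeff n \<ge> 0"
  by (auto simp: outer_coeff_def inner_coeff_nonneg intro!: divide_nonneg_nonneg sum_nonneg)

lemma outer_coeff_has_sum: "(outer_coeff has_sum (13 / 48 * zeta 3)) UNIV"
proof (rule sums_nonneg_imp_has_sum[OF _ outer_coeff_nonneg])
  show "outer_coeff sums (13 / 48 * zeta 3)"
    by (rule sums_at_1_if_nonneg[OF outer_coeff_nonneg _ tendsto_outer_series])
      (intro outer_series_sums, simp)
qed

theorem theorem5p1:
  shows "((\<lambda>(k, m, n). 1 / 3 ^ n * (1 / (real k * real (k + m) * real (k + m + n))))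
            has_sum (13 / 48 * zeta 3))
          {(k :: nat, m :: nat, n :: nat). k \<ge> 1 \<and> m \<ge> 1 \<and> n \<ge> 1 \<and> odd k}"
proof -
  \<comment> \<open>With \<open>l = k + m\<close> and \<open>Suc p = k + m + n\<close>, the bounds
    \<open>k < l\<close> and \<open>l \<le> p\<close> express that \<open>m\<close> and
    \<open>n\<close> are positive, and each fixed \<open>p\<close> leaves a finite sum.\<close>
  define f :: "nat \<times> nat \<times> nat \<Rightarrow> real" where
    "f = (\<lambda>(p, l, k). 1 / 3 ^ (Suc p - l) * (1 / (real k * real l * real (Suc p))))"
  define B where "B p = Sigma {..p} (\<lambda>l. {k. k < l \<and> odd k})" for p :: nat
  have fin: "finite (B p)" for p by (auto simp: B_def)
  have f: "((\<lambda>y. f (p, y)) has_sum outer_coeff p) (B p)" for p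
  proof -
    have "(\<Sum>y\<in>B p. f (p, y)) = (\<Sum>l\<le>p. \<Sum>k | k < l \<and> odd k. f (p, l, k))"
      unfolding B_def by (subst sum.Sigma) auto
    also have "\<dots> = (\<Sum>l\<le>p. inner_coeff l * (1 / 3) ^ (p - l) / (3 * real (Suc p)))"
    proof (rule sum.cong)
      fix l assume "l \<in> {..p}"
      then have l: "Suc p - l = Suc (p - l)" by (simp add: Suc_diff_le)
      have "inner_coeff l = (\<Sum>k | k < l \<and> odd k. 1 / k) / l"
        unfolding inner_coeff_def recip_odd_def
        by (subst sum.inter_filter[symmetric]) (auto intro!: arg_cong2[of _ _ _ _ sum])
      then show "(\<Sum>k | k < l \<and> odd k. f (p, l, k)) =
          inner_coeff l * (1 / 3) ^ (p - l) / (3 * real (Suc p))"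
        by (simp add: f_def l sum_divide_distrib sum_distrib_right power_one_over mult_ac distrib_left)
    qed simp
    also have "\<dots> = outer_coeff p"
      by (simp add: outer_coeff_def sum_divide_distrib)
    finally show ?thesis using has_sum_finite[OF fin] by metis
  qed
  have "(f has_sum (13 / 48 * zeta 3)) (Sigma UNIV B)"
  \<comment> \<open>Nonnegativity of \<open>f\<close> turns summability of the iterated sum into
    summability over all triples.\<close>
  proof (rule has_sum_SigmaI[OF f outer_coeff_has_sum])
    show "f summable_on Sigma UNIV B"
      by (rule summable_on_SigmaI[OF f has_sum_imp_summable[OF outer_coeff_has_sum]])
        (auto simp: f_def)
  qed
  moreover have "((\<lambda>(k, m, n). 1 / 3 ^ n * (1 / (real k * real (k + m) * real (k + m + n))))
      has_sum (13 / 48 * zeta 3)) {(k :: nat, m :: nat, n :: nat). k \<ge> 1 \<and> m \<ge> 1 \<and> n \<ge> 1 \<and> odd k}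
    \<longleftrightarrow> (f has_sum (13 / 48 * zeta 3)) (Sigma UNIV B)"
    by (rule has_sum_reindex_bij_witness[where j = "\<lambda>(k, m, n). (k + m + n - 1, k + m, k)"
          and i = "\<lambda>(p, l, k). (k, l - k, Suc p - l)"])
      (auto simp: B_def f_def Suc_diff_le odd_pos Suc_le_eq)
  ultimately show ?thesis by simp
qed

end
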